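(* The following bounds hold on all admissible tuples (with $r_2=1$ and $n=6,7,8,9$ respectively): $$P_{6,1}\le 34.89,\qquad P_{7,1}\le 65.81,\qquad P_{8,1}\le 80,\qquad P_{9,1}\le 233.1.$$
   Context: For integers $n\ge 2$ and $r_2\ge 0$ with $2r_2\le n$, an $n$-tuple $(y_1,\dots,y_n)$ of complex numbers is called admissible (for $n,r_2$) if: (A) $0<|y_1|\le |y_2|\le\cdots\le|y_n|$; and (B) among the $y_i$ there are $r_2$ pairs of complex conjugate non-real numbers, while all the remaining $y_i$ are real. On admissible $n$-tuples define $$P_{n,r_2}(y_1,\dots,y_n):=\prod_{1\le i<j\le n}\left|1-\frac{y_i}{y_j}\right|.$$ *)

theory Defs imports Complex_Main begin

text \<open>
  An n-tuple is represented by a function on nat of which only the values at the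
  indices 1, ..., n matter. The k-th pair of complex conjugate numbers sits at the indices
  \<open>a k\<close> and \<open>b k\<close>, which need not be adjacent; the \<open>2 * r2\<close> indices are pairwise distinct, but
  the values may repeat.
\<close>
definition admissible :: "nat \<Rightarrow> nat \<Rightarrow> (nat \<Rightarrow> complex) \<Rightarrow> bool" where
  "admissible n r2 y \<longleftrightarrow>
     n \<ge> 2 \<and> 2 * r2 \<le> n \<and>
     0 < cmod (y 1) \<and>
     (\<forall>i\<in>{1..<n}. cmod (y i) \<le> cmod (y (i + 1))) \<and>
     (\<exists>a b :: nat \<Rightarrow> nat.
        inj_on a {1..r2} \<and> inj_on b {1..r2} \<and>
        a ` {1..r2} \<inter> b ` {1..r2} = {} \<and>
        a ` {1..r2} \<union> b ` {1..r2} \<subseteq> {1..n} \<and>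
        (\<forall>k\<in>{1..r2}. y (a k) \<notin> \<real> \<and> y (b k) = cnj (y (a k))) \<and>
        (\<forall>i\<in>{1..n} - (a ` {1..r2} \<union> b ` {1..r2}). y i \<in> \<real>))"

definition pohst_prod :: "nat \<Rightarrow> (nat \<Rightarrow> complex) \<Rightarrow> real" where
  "pohst_prod n y = (\<Prod>(i, j)\<in>{(i, j). 1 \<le> i \<and> i < j \<and> j \<le> n}. cmod (1 - y i / y j))"

lemma finite_index_pairs: "finite {(i, j). 1 \<le> i \<and> i < j \<and> j \<le> (n :: nat)}"
  by (rule finite_subset[of _ "{..n} \<times> {..n}"]) auto

end

(*
  For i < j the factor |1 - y_i / y_j| is |y_i - y_j| / max |y_i| |y_j|, so the order of the moduli
  plays no further role. Split the real y_i, by their sign relative to the real part of the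
  non-real pair z, cnj z, into G (same sign) and H. With t_ij the ratio of the smaller modulus to
  the larger one, real pairs contribute 1 - t_ij or 1 + t_ij according as their signs agree, and
  the factors of y_i with z and cnj z give 1 -+ 2 c u_i + u_i^2, where c = |cos (arg z)|,
  u_i is the modulus ratio of y_i and z.

  The function ln (1 + exp (- d)) is a positive mixture of the tents max 0 (a - d) and a constant,
  and the energy of a tent is the integral of the square of an integer-valued function. This bounds
  the product of 1 + t_ij over G x H by 2^min(|G|, |H|) times the product of 1 + t_ij over the pairs
  within G and within H; combined with the factors 1 - t_ij, these pairs contribute 1 - t_ij^2.
  Each of the two clusters that remain is estimated by removing its elements one by one. For
  c >= 1/2 an extra charge at |z| is added to G first.
*)
theory Submission imports Defs "HOL-Analysis.Analysis" begin

section \<open>Energy of signed charges on a line\<close>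

text \<open>For symmetric \<open>k\<close>, the quadratic form of charges 1 on \<open>G\<close> and
  -1 on \<open>H\<close>. Diagonal terms are kept, so that a product kernel b i * b j gives a
  perfect square.\<close>

definition charge_energy :: "'a set \<Rightarrow> 'a set \<Rightarrow> ('a \<Rightarrow> 'a \<Rightarrow> real) \<Rightarrow> real" where
  "charge_energy G H k =
     (\<Sum>i\<in>G. \<Sum>j\<in>G. k i j) + (\<Sum>i\<in>H. \<Sum>j\<in>H. k i j) - 2 * (\<Sum>i\<in>G. \<Sum>j\<in>H. k i j)"

lemma charge_energy_add:
  "charge_energy G H (\<lambda>i j. k i j + l i j) = charge_energy G H k + charge_energy G H l"
  by (simp add: charge_energy_def sum.distrib algebra_simps)

lemma charge_energy_scale:
  "charge_energy G H (\<lambda>i j. c * k i j) = c * charge_energy G H k"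
  by (simp add: charge_energy_def sum_distrib_left algebra_simps)

lemma charge_energy_const:
  assumes "finite G" "finite H"
  shows "charge_energy G H (\<lambda>i j. c) = c * (real (card G) - real (card H))\<^sup>2"
  by (simp add: charge_energy_def power2_eq_square algebra_simps)

lemma charge_energy_cong:
  assumes "\<And>i j. i \<in> G \<union> H \<Longrightarrow> j \<in> G \<union> H \<Longrightarrow> k i j = l i j"
  shows "charge_energy G H k = charge_energy G H l"
  using assms by (simp add: charge_energy_def)

lemma abs_int_le_square: "\<bar>of_int m\<bar> \<le> (of_int m :: real)\<^sup>2"
proof (cases "m = 0")
  case False
  then have "1 \<le> \<bar>m\<bar>" by simp
  then have "1 \<le> \<bar>of_int m :: real\<bar>" by linarith
  then have "\<bar>of_int m :: real\<bar> * 1 \<le> \<bar>of_int m\<bar> * \<bar>of_int m\<bar>" by (intro mult_left_mono) auto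
  then show ?thesis by (simp add: power2_eq_square)
qed simp

lemma integer_diff_squares:
  fixes p q :: nat
  shows "\<bar>real p - real q\<bar> \<le> (real p - real q)\<^sup>2"
  using abs_int_le_square[of "int p - int q"] by simp

text \<open>A tent is the autocorrelation of the indicator of an interval. This writes the tent
  kernel as an integral of product kernels.\<close>

lemma has_bochner_integral_overlap:
  fixes s t a :: real
  assumes "a \<ge> 0"
  shows "has_bochner_integral lborel (\<lambda>w. indicator {s..s + a} w * indicator {t..t + a} w :: real)
           (max 0 (a - \<bar>s - t\<bar>))"
proof -
  have "{s..s + a} \<inter> {t..t + a} = {max s t..min s t + a}" by auto
  then have eq: "(\<lambda>w. indicator {s..s + a} w * indicator {t..t + a} w :: real)
      = indicator {max s t..min s t + a}"
    by (auto simp: fun_eq_iff indicator_def)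
  have m: "measure lborel {max s t..min s t + a} = max 0 (a - \<bar>s - t\<bar>)"
    by (auto simp: measure_def emeasure_lborel_Icc_eq)
  show ?thesis unfolding eq m[symmetric]
    by (rule has_bochner_integral_real_indicator) (auto simp: emeasure_lborel_Icc_eq)
qed

text \<open>The tent energy is the integral of \<open>\<sigma>\<^sup>2\<close>, where the integer-valued \<open>\<sigma>\<close> counts the
  intervals \<open>{x i..x i + a}\<close> over a point with sign, and \<open>\<sigma>\<^sup>2 \<ge> \<bar>\<sigma>\<bar>\<close>.\<close>

lemma tent_energy_ge:
  fixes x :: "'a \<Rightarrow> real"
  assumes "finite G" "finite H" "a \<ge> 0"
  shows "a * \<bar>real (card G) - real (card H)\<bar>
         \<le> charge_energy G H (\<lambda>i j. max 0 (a - \<bar>x i - x j\<bar>))"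
proof -
  define b where "b i w = (indicator {x i..x i + a} w :: real)" for i w
  define \<sigma> where "\<sigma> w = (\<Sum>i\<in>G. b i w) - (\<Sum>i\<in>H. b i w)" for w
  have bb: "has_bochner_integral lborel (\<lambda>w. b i w * b j w) (max 0 (a - \<bar>x i - x j\<bar>))" for i j
    unfolding b_def using assms(3) by (rule has_bochner_integral_overlap)
  have "(\<lambda>w. b i w * b i w) = b i" for i by (auto simp: fun_eq_iff b_def indicator_def)
  then have b1: "has_bochner_integral lborel (b i) a" for i
    using bb[of i i] assms(3) by simp
  have sq: "(\<sigma> w)\<^sup>2 = charge_energy G H (\<lambda>i j. b i w * b j w)" for w
    unfolding \<sigma>_def charge_energy_def power2_eq_square sum_product[symmetric]
    by (simp add: algebra_simps)
  have I2: "has_bochner_integral lborel (\<lambda>w. (\<sigma> w)\<^sup>2)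
      (charge_energy G H (\<lambda>i j. max 0 (a - \<bar>x i - x j\<bar>)))"
    unfolding sq unfolding charge_energy_def
    by (intro has_bochner_integral_add has_bochner_integral_diff has_bochner_integral_sum
        has_bochner_integral_mult_right bb)
  have I1: "has_bochner_integral lborel \<sigma> ((\<Sum>i\<in>G. a) - (\<Sum>i\<in>H. a))"
    unfolding \<sigma>_def by (intro has_bochner_integral_diff has_bochner_integral_sum b1)
  have ge: "\<bar>\<sigma> w\<bar> \<le> (\<sigma> w)\<^sup>2" for w
  proof -
    have "\<sigma> w = of_int ((\<Sum>i\<in>G. indicator {x i..x i + a} w) - (\<Sum>i\<in>H. indicator {x i..x i + a} w))"
      by (simp add: \<sigma>_def b_def indicator_def if_distrib cong: if_cong)
    then show ?thesis by (simp only: abs_int_le_square)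
  qed
  have "\<bar>integral\<^sup>L lborel \<sigma>\<bar> \<le> integral\<^sup>L lborel (\<lambda>w. (\<sigma> w)\<^sup>2)"
    using ge I1 I2
    by (intro order_trans[OF integral_abs_bound] integral_mono) (auto simp: has_bochner_integral_iff)
  moreover have "\<bar>integral\<^sup>L lborel \<sigma>\<bar> = a * \<bar>real (card G) - real (card H)\<bar>"
  proof -
    have "integral\<^sup>L lborel \<sigma> = a * (real (card G) - real (card H))"
      using I1 by (simp add: has_bochner_integral_iff algebra_simps)
    then show ?thesis using assms(3) by (simp add: abs_mult)
  qed
  ultimately show ?thesis using I2 by (simp add: has_bochner_integral_iff)
qed

text \<open>Taylor's formula at \<open>D\<close> with integral remainder: \<open>ln (1 + exp (- d))\<close> is, for
  \<open>0 \<le> d \<le> D\<close>, a constant plus a positive mixture of tents.\<close>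

lemma softplus_tent_mixture:
  fixes d D :: real
  assumes "0 \<le> d" "d \<le> D"
  shows "((\<lambda>a. exp (- a) / (1 + exp (- a))\<^sup>2 * max 0 (a - d)) has_integral
           ln (1 + exp (- d)) - ln (1 + exp (- D)) - exp (- D) / (1 + exp (- D)) * max 0 (D - d)) {0..D}"
proof -
  \<comment> \<open>With h a = ln (1 + exp (- a)), this is h' a * (a - d) - h a, whose derivative is
    h'' a * (a - d); the weight of the mixture is h''.\<close>
  define F where "F a = - exp (- a) / (1 + exp (- a)) * (a - d) - ln (1 + exp (- a))" for a :: real
  have pos: "1 + exp (- a) > 0" for a :: real by (simp add: add_pos_pos)
  have nz: "1 + exp (- a) \<noteq> 0" for a :: real using pos[of a] by linarith
  have "((\<lambda>a. exp (- a) / (1 + exp (- a))\<^sup>2 * (a - d)) has_integral F D - F d) {d..D}"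
  proof (rule fundamental_theorem_of_calculus[OF assms(2)])
    fix a assume "a \<in> {d..D}"
    have e: "((\<lambda>a. exp (- a)) has_real_derivative - exp (- a)) (at a within {d..D})"
      by (auto intro!: derivative_eq_intros)
    have "(F has_real_derivative
        (- (- exp (- a)) * (1 + exp (- a)) - - exp (- a) * (- exp (- a)))
          / ((1 + exp (- a)) * (1 + exp (- a))) * (a - d)
        + 1 * (- exp (- a) / (1 + exp (- a))) - 1 / (1 + exp (- a)) * (- exp (- a))) (at a within {d..D})"
      unfolding F_def
      by (rule derivative_eq_intros refl e nz pos | simp add: field_simps)+
    then have "(F has_real_derivative exp (- a) / (1 + exp (- a))\<^sup>2 * (a - d)) (at a within {d..D})"
      by (rule DERIV_cong) (simp add: power2_eq_square algebra_simps)
    then show "(F has_vector_derivative exp (- a) / (1 + exp (- a))\<^sup>2 * (a - d)) (at a within {d..D})"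
      by (simp add: has_real_derivative_iff_has_vector_derivative)
  qed
  then have 1: "((\<lambda>a. exp (- a) / (1 + exp (- a))\<^sup>2 * max 0 (a - d)) has_integral F D - F d) {d..D}"
    by (rule has_integral_eq[rotated]) auto
  have 2: "((\<lambda>a. exp (- a) / (1 + exp (- a))\<^sup>2 * max 0 (a - d)) has_integral 0) {0..d}"
    by (rule has_integral_is_0) auto
  have "F D - F d = ln (1 + exp (- d)) - ln (1 + exp (- D))
      - exp (- D) / (1 + exp (- D)) * max 0 (D - d)"
    using assms by (simp add: F_def)
  with has_integral_combine[OF assms 2 1] show ?thesis by simp
qed

text \<open>Integrating \<open>tent_energy_ge\<close> over the mixture yields |card G - card H|
  times the value of the kernel at distance 0, which is ln 2. The constant of the mixture is handled
  by the integrality of card G - card H.\<close>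

lemma softplus_energy_ge:
  fixes x :: "'a \<Rightarrow> real"
  assumes "finite G" "finite H"
  shows "ln 2 * \<bar>real (card G) - real (card H)\<bar>
         \<le> charge_energy G H (\<lambda>i j. ln (1 + exp (- \<bar>x i - x j\<bar>)))"
proof -
  \<comment> \<open>The mixture formula holds for d <= D, so a common bound for all distances is
    taken; a sum also covers the empty case.\<close>
  define D where "D = (\<Sum>i\<in>G \<union> H. \<Sum>j\<in>G \<union> H. \<bar>x i - x j\<bar>)"
  have D: "\<bar>x i - x j\<bar> \<le> D" if "i \<in> G \<union> H" "j \<in> G \<union> H" for i j
  proof -
    have "\<bar>x i - x j\<bar> \<le> (\<Sum>j\<in>G \<union> H. \<bar>x i - x j\<bar>)"
      using that assms by (intro member_le_sum) auto
    also have "\<dots> \<le> D" unfolding D_def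
      using that assms by (intro member_le_sum[of i _ "\<lambda>i. \<Sum>j\<in>G \<union> H. \<bar>x i - x j\<bar>"]) (auto intro: sum_nonneg)
    finally show ?thesis .
  qed
  have D0: "D \<ge> 0" unfolding D_def by (intro sum_nonneg) auto
  define \<Delta> where "\<Delta> = \<bar>real (card G) - real (card H)\<bar>"
  define T where "T a = charge_energy G H (\<lambda>i j. max 0 (a - \<bar>x i - x j\<bar>))" for a
  define w where "w a = exp (- a) / (1 + exp (- a))\<^sup>2" for a :: real
  define \<alpha> where "\<alpha> = ln (1 + exp (- D))"
  define \<beta> where "\<beta> = exp (- D) / (1 + exp (- D))"
  \<comment> \<open>\<open>r\<close> is the mixture of the tents with a <= D; the rest of the kernel
    is the constant \<open>\<alpha>\<close> plus \<open>\<beta>\<close> times the tent with a =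
    D.\<close>
  define r where "r d = ln (1 + exp (- d)) - \<alpha> - \<beta> * max 0 (D - d)" for d
  have mix: "((\<lambda>a. w a * max 0 (a - d)) has_integral r d) {0..D}" if "0 \<le> d" "d \<le> D" for d
    using softplus_tent_mixture[OF that] by (simp add: w_def r_def \<alpha>_def \<beta>_def)
  have int: "((\<lambda>a. w a * T a) has_integral charge_energy G H (\<lambda>i j. r \<bar>x i - x j\<bar>)) {0..D}"
    unfolding T_def charge_energy_scale[symmetric] unfolding charge_energy_def
    by (intro has_integral_add has_integral_diff has_integral_sum has_integral_mult_right mix assms)
       (use D in auto)
  have int0: "((\<lambda>a. \<Delta> * (w a * max 0 (a - 0))) has_integral \<Delta> * r 0) {0..D}"
    by (intro has_integral_mult_right mix) (use D0 in auto)
  have "\<Delta> * r 0 \<le> charge_energy G H (\<lambda>i j. r \<bar>x i - x j\<bar>)"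
  proof (rule has_integral_le[OF int0 int])
    fix a assume "a \<in> {0..D}"
    then have "a * \<Delta> \<le> T a"
      unfolding T_def \<Delta>_def using assms by (intro tent_energy_ge) auto
    then have "w a * (a * \<Delta>) \<le> w a * T a" by (intro mult_left_mono) (simp_all add: w_def)
    then show "\<Delta> * (w a * max 0 (a - 0)) \<le> w a * T a"
      using \<open>a \<in> {0..D}\<close> by (simp add: mult_ac)
  qed
  moreover have "D * \<Delta> \<le> T D" unfolding T_def \<Delta>_def using assms D0 by (intro tent_energy_ge)
  then have "\<beta> * (D * \<Delta>) \<le> \<beta> * T D" by (intro mult_left_mono) (simp_all add: \<beta>_def add_nonneg_nonneg)
  moreover have "\<alpha> * \<Delta> \<le> \<alpha> * (real (card G) - real (card H))\<^sup>2"
    unfolding \<Delta>_def by (intro mult_left_mono integer_diff_squares) (simp add: \<alpha>_def)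
  moreover have "charge_energy G H (\<lambda>i j. ln (1 + exp (- \<bar>x i - x j\<bar>)))
     = charge_energy G H (\<lambda>i j. r \<bar>x i - x j\<bar> + (\<alpha> + \<beta> * max 0 (D - \<bar>x i - x j\<bar>)))"
    by (simp add: r_def)
  then have "charge_energy G H (\<lambda>i j. ln (1 + exp (- \<bar>x i - x j\<bar>)))
     = charge_energy G H (\<lambda>i j. r \<bar>x i - x j\<bar>) + (\<alpha> * (real (card G) - real (card H))\<^sup>2 + \<beta> * T D)"
    by (simp only: charge_energy_add charge_energy_scale charge_energy_const[OF assms] T_def)
  moreover have "r 0 = ln 2 - \<alpha> - \<beta> * D" using D0 by (simp add: r_def)
  ultimately show ?thesis unfolding \<Delta>_def[symmetric] by (simp add: algebra_simps)
qed

section \<open>Products over unordered pairs\<close>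

definition pair_prod :: "('a :: linorder \<Rightarrow> 'a \<Rightarrow> real) \<Rightarrow> 'a set \<Rightarrow> real" where
  "pair_prod g S = (\<Prod>(i, j)\<in>{(i, j). i \<in> S \<and> j \<in> S \<and> i < j}. g i j)"

lemma finite_ordered_pairs:
  fixes S :: "'a :: linorder set"
  shows "finite S \<Longrightarrow> finite {(i, j). i \<in> S \<and> j \<in> S \<and> i < j}"
  by (rule finite_subset[of _ "S \<times> S"]) auto

lemma pair_prod_empty [simp]: "pair_prod g {} = 1"
  by (simp add: pair_prod_def)

lemma pair_prod_insert:
  fixes S :: "'a :: linorder set"
  assumes "finite S" "k \<notin> S" and sym: "\<And>i j. g i j = g j i"
  shows "pair_prod g (insert k S) = (\<Prod>j\<in>S. g k j) * pair_prod g S"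
proof -
  \<comment> \<open>Sorting \<open>k\<close> and \<open>j\<close> makes the pairs that contain
    \<open>k\<close> an injective image of \<open>S\<close>.\<close>
  let ?f = "\<lambda>j. (min k j, max k j)"
  have eq: "{(i, j). i \<in> insert k S \<and> j \<in> insert k S \<and> i < j}
      = ?f ` S \<union> {(i, j). i \<in> S \<and> j \<in> S \<and> i < j}"
  proof (intro equalityI subsetI)
    fix p assume "p \<in> {(i, j). i \<in> insert k S \<and> j \<in> insert k S \<and> i < j}"
    moreover have "(k, j) \<in> ?f ` S" if "j \<in> S" "k < j" for j
      using that by (intro image_eqI[of _ _ j]) auto
    moreover have "(j, k) \<in> ?f ` S" if "j \<in> S" "j < k" for j
      using that by (intro image_eqI[of _ _ j]) auto
    ultimately show "p \<in> ?f ` S \<union> {(i, j). i \<in> S \<and> j \<in> S \<and> i < j}" by auto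
  next
    fix p assume "p \<in> ?f ` S \<union> {(i, j). i \<in> S \<and> j \<in> S \<and> i < j}"
    moreover have "?f j \<in> {(i, j). i \<in> insert k S \<and> j \<in> insert k S \<and> i < j}" if "j \<in> S" for j
    proof -
      have "j \<noteq> k" using that assms(2) by auto
      then show ?thesis using that by (cases rule: neqE[of j k]) auto
    qed
    moreover have "{(i, j). i \<in> S \<and> j \<in> S \<and> i < j}
        \<subseteq> {(i, j). i \<in> insert k S \<and> j \<in> insert k S \<and> i < j}" by auto
    ultimately show "p \<in> {(i, j). i \<in> insert k S \<and> j \<in> insert k S \<and> i < j}"
      by (elim UnE imageE) (simp_all only: subset_eq)
  qed
  have "inj_on ?f S" by (auto simp: inj_on_def min_def max_def split: if_splits)
  moreover have "g (min k j) (max k j) = g k j" for j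
    using sym by (simp add: min_def max_def)
  ultimately have "(\<Prod>(i, j)\<in>?f ` S. g i j) = (\<Prod>j\<in>S. g k j)"
    by (simp add: prod.reindex)
  moreover have "?f ` S \<inter> {(i, j). i \<in> S \<and> j \<in> S \<and> i < j} = {}"
    using assms(2) by (auto simp: min_def max_def split: if_splits)
  ultimately show ?thesis unfolding pair_prod_def eq
    using assms(1) finite_ordered_pairs[OF assms(1)] by (subst prod.union_disjoint) auto
qed

lemma pair_prod_Un:
  fixes S T :: "'a :: linorder set"
  assumes "finite S" "finite T" "S \<inter> T = {}" and sym: "\<And>i j. g i j = g j i"
  shows "pair_prod g (S \<union> T) = pair_prod g S * pair_prod g T * (\<Prod>i\<in>S. \<Prod>j\<in>T. g i j)"
  using assms(1,3)
proof (induction S)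
  case (insert k S)
  have "pair_prod g (insert k S \<union> T) = (\<Prod>j\<in>S \<union> T. g k j) * pair_prod g (S \<union> T)"
    using insert.hyps insert.prems assms(2) by (simp add: pair_prod_insert[OF _ _ sym])
  also have "(\<Prod>j\<in>S \<union> T. g k j) = (\<Prod>j\<in>S. g k j) * (\<Prod>j\<in>T. g k j)"
    using insert.hyps insert.prems assms(2) by (intro prod.union_disjoint) auto
  finally show ?case
    using insert by (simp add: pair_prod_insert[OF _ _ sym] algebra_simps)
qed simp

text \<open>Ordered pairs consist of the diagonal and two copies of the unordered pairs. This
  converts the same-sign double sums of \<open>charge_energy\<close> into
  \<open>pair_prod\<close>.\<close>

lemma prod_prod_eq_diagonal_pair_prod:
  fixes S :: "'a :: linorder set"
  assumes "finite S" and sym: "\<And>i j. g i j = g j i"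
  shows "(\<Prod>i\<in>S. \<Prod>j\<in>S. g i j) = (\<Prod>i\<in>S. g i i) * (pair_prod g S)\<^sup>2"
  using assms(1)
proof (induction S)
  case (insert k S)
  have "(\<Prod>i\<in>insert k S. \<Prod>j\<in>insert k S. g i j)
      = g k k * (\<Prod>j\<in>S. g k j) * ((\<Prod>i\<in>S. g i k) * (\<Prod>i\<in>S. \<Prod>j\<in>S. g i j))"
    using insert.hyps by (simp add: prod.distrib)
  also have "(\<Prod>i\<in>S. g i k) = (\<Prod>i\<in>S. g k i)" using sym by (intro prod.cong) auto
  finally show ?case
    using insert by (simp add: pair_prod_insert[OF _ _ sym] power_mult_distrib power2_eq_square algebra_simps)
qed simp

lemma pair_prod_mult:
  "pair_prod (\<lambda>i j. g i j * h i j) S = pair_prod g S * pair_prod h S"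
  by (simp add: pair_prod_def prod.distrib case_prod_unfold)

lemma pair_prod_pos:
  assumes "\<And>i j. i \<in> S \<Longrightarrow> j \<in> S \<Longrightarrow> g i j > 0"
  shows "pair_prod g S > 0"
  unfolding pair_prod_def using assms by (intro prod_pos) auto

lemma pair_prod_nonneg:
  assumes "\<And>i j. i \<in> S \<Longrightarrow> j \<in> S \<Longrightarrow> g i j \<ge> 0"
  shows "pair_prod g S \<ge> 0"
  unfolding pair_prod_def using assms by (intro prod_nonneg) auto

lemma pair_prod_cong:
  assumes "\<And>i j. i \<in> S \<Longrightarrow> j \<in> S \<Longrightarrow> i < j \<Longrightarrow> g i j = h i j"
  shows "pair_prod g S = pair_prod h S"
  unfolding pair_prod_def using assms by (intro prod.cong) auto

section \<open>Modulus ratios and factors of opposite sign\<close>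

definition ratio :: "real \<Rightarrow> real \<Rightarrow> real" where
  "ratio a b = min a b / max a b"

lemma ratio_commute: "ratio a b = ratio b a"
  by (simp add: ratio_def min.commute max.commute)

lemma ratio_self: "a > 0 \<Longrightarrow> ratio a a = 1"
  by (simp add: ratio_def)

lemma ratio_pos: "a > 0 \<Longrightarrow> b > 0 \<Longrightarrow> ratio a b > 0"
  by (simp add: ratio_def)

lemma ratio_le_1: "a > 0 \<Longrightarrow> b > 0 \<Longrightarrow> ratio a b \<le> 1"
  by (simp add: ratio_def max_def min_def)

text \<open>In logarithmic coordinates, ln (1 + ratio) is the kernel of
  \<open>softplus_energy_ge\<close>.\<close>

lemma ratio_eq_exp:
  assumes "a > 0" "b > 0"
  shows "ratio a b = exp (- \<bar>ln a - ln b\<bar>)"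
proof -
  have "ratio a b = exp (- \<bar>ln a - ln b\<bar>)" if "a > 0" "b > 0" "a \<le> b" for a b
  proof -
    have "ratio a b = exp (ln a - ln b)" using that by (simp add: ratio_def exp_diff)
    also have "ln a - ln b = - \<bar>ln a - ln b\<bar>" using that by simp
    finally show ?thesis .
  qed
  from this[of a b] this[of b a] show ?thesis using assms
    by (metis abs_minus_commute linear ratio_commute)
qed

text \<open>The lower bound on the energy of charges \<open>1\<close> on \<open>G\<close> and \<open>- 1\<close> on \<open>H\<close> at the points
  \<open>ln (m i)\<close>, exponentiated.\<close>

lemma prod_opposite_le:
  fixes m :: "'a :: linorder \<Rightarrow> real"
  assumes fin: "finite G" "finite H" and pos: "\<And>i. i \<in> G \<union> H \<Longrightarrow> m i > 0"
  shows "(\<Prod>i\<in>G. \<Prod>j\<in>H. 1 + ratio (m i) (m j))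
    \<le> 2 ^ min (card G) (card H) * pair_prod (\<lambda>i j. 1 + ratio (m i) (m j)) G
        * pair_prod (\<lambda>i j. 1 + ratio (m i) (m j)) H"
proof -
  define g where "g i j = 1 + ratio (m i) (m j)" for i j
  have gpos: "g i j > 0" if "i \<in> G \<union> H" "j \<in> G \<union> H" for i j
    using ratio_pos[OF pos[OF that(1)] pos[OF that(2)]] by (simp add: g_def)
  have sym: "g i j = g j i" for i j by (simp add: g_def ratio_commute)
  have diag: "(\<Prod>i\<in>S. g i i) = 2 ^ card S" if "S \<subseteq> G \<union> H" for S
  proof -
    have "(\<Prod>i\<in>S. g i i) = (\<Prod>i\<in>S. 2)"
      using that pos by (intro prod.cong) (auto simp: g_def ratio_self)
    then show ?thesis by simp
  qed
  have lnpp: "(\<Sum>i\<in>S. \<Sum>j\<in>T. ln (g i j)) = ln (\<Prod>i\<in>S. \<Prod>j\<in>T. g i j)"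
    if "S \<subseteq> G \<union> H" "T \<subseteq> G \<union> H" for S T
  proof -
    have "finite S" "finite T" using that fin by (auto intro: finite_subset)
    moreover have "(\<Prod>j\<in>T. g i j) > 0" if "i \<in> S" for i
      using that \<open>S \<subseteq> _\<close> \<open>T \<subseteq> _\<close> gpos by (intro prod_pos) auto
    ultimately show ?thesis using that gpos
      by (subst ln_prod) (auto intro!: sum.cong ln_prod[symmetric] simp: less_imp_neq[symmetric] subset_iff)
  qed
  have P: "pair_prod g S > 0" if "S \<subseteq> G \<union> H" for S
    using that gpos by (intro pair_prod_pos) auto
  have same: "(\<Sum>i\<in>S. \<Sum>j\<in>S. ln (g i j)) = card S * ln 2 + 2 * ln (pair_prod g S)"
    if "S \<subseteq> G \<union> H" for S
    using lnpp[OF that that] P[OF that] prod_prod_eq_diagonal_pair_prod[of S g] sym that fin diag[OF that]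
    by (simp add: finite_subset[OF that] ln_mult ln_realpow)
  define Q where "Q = (\<Prod>i\<in>G. \<Prod>j\<in>H. g i j)"
  have Qpos: "Q > 0" unfolding Q_def using gpos by (intro prod_pos) auto
  have "charge_energy G H (\<lambda>i j. ln (1 + exp (- \<bar>ln (m i) - ln (m j)\<bar>)))
      = charge_energy G H (\<lambda>i j. ln (g i j))"
    using pos by (intro charge_energy_cong) (simp add: g_def ratio_eq_exp)
  also have "\<dots> = card G * ln 2 + 2 * ln (pair_prod g G)
      + (card H * ln 2 + 2 * ln (pair_prod g H)) - 2 * ln Q"
    unfolding charge_energy_def Q_def by (simp add: same lnpp)
  finally have "ln 2 * \<bar>real (card G) - real (card H)\<bar> \<le> card G * ln 2 + 2 * ln (pair_prod g G)
      + (card H * ln 2 + 2 * ln (pair_prod g H)) - 2 * ln Q"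
    using softplus_energy_ge[OF fin, of "\<lambda>i. ln (m i)"] by simp
  \<comment> \<open>The diagonals contribute (card G + card H) * ln 2, and the energy is at least
    |card G - card H| * ln 2; half the gap gives the exponent of 2.\<close>
  moreover have "card G * ln 2 + card H * ln 2 - ln 2 * \<bar>real (card G) - real (card H)\<bar>
      = 2 * (min (card G) (card H) * ln 2)"
    by (simp add: min_def abs_if algebra_simps)
  ultimately have "ln Q \<le> min (card G) (card H) * ln 2 + ln (pair_prod g G) + ln (pair_prod g H)"
    by linarith
  also have "\<dots> = ln (2 ^ min (card G) (card H) * pair_prod g G * pair_prod g H)"
    using P[of G] P[of H] by (simp add: ln_mult ln_realpow)
  finally have "Q \<le> 2 ^ min (card G) (card H) * pair_prod g G * pair_prod g H"
    using Qpos P[of G] P[of H] by (subst (asm) ln_le_cancel_iff) auto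
  then show ?thesis unfolding Q_def g_def .
qed

section \<open>A cluster of moduli around a fixed modulus\<close>

lemma prod_le_factor:
  fixes f :: "'a \<Rightarrow> real"
  assumes "finite S" "j \<in> S" "\<And>i. i \<in> S \<Longrightarrow> 0 \<le> f i \<and> f i \<le> 1"
  shows "(\<Prod>i\<in>S. f i) \<le> f j"
proof -
  have "(\<Prod>i\<in>S. f i) = f j * (\<Prod>i\<in>S - {j}. f i)" using assms by (simp add: prod.remove)
  also have "\<dots> \<le> f j * 1" using assms by (intro mult_left_mono prod_le_1) auto
  finally show ?thesis by simp
qed

text \<open>\<open>b\<close> lies between \<open>a\<close> and \<open>r\<close>, so on a logarithmic
  scale \<open>r\<close> is at least as far from \<open>a\<close>. A factor 1 - ratio^2 with a
  neighbour can thus be replaced by the one with \<open>r\<close>.\<close>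

lemma ratio_trans_le:
  assumes "a > 0" "b > 0" "r > 0" and "a \<le> b \<and> b \<le> r \<or> r \<le> b \<and> b \<le> a"
  shows "ratio a r \<le> ratio a b"
  using assms by (auto simp: ratio_def min_def max_def divide_simps intro: mult_left_mono)

text \<open>Of two elements on the same side of \<open>r\<close>, the one farther from \<open>r\<close> can be removed at the
  cost of a factor \<open>K\<close>; so only one element on each side matters.\<close>

lemma cluster_prod_le:
  fixes m :: "'a :: linorder \<Rightarrow> real" and f :: "real \<Rightarrow> real"
  assumes "finite S" and pos: "\<And>i. i \<in> S \<Longrightarrow> m i > 0" and r: "r > 0" and K: "K \<ge> 1" and M: "M \<ge> 1"
    and f0: "\<And>v. 0 \<le> v \<Longrightarrow> v \<le> 1 \<Longrightarrow> 0 \<le> f v"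
    and fM: "\<And>v. 0 \<le> v \<Longrightarrow> v \<le> 1 \<Longrightarrow> f v \<le> M"
    and fK: "\<And>v. 0 \<le> v \<Longrightarrow> v \<le> 1 \<Longrightarrow> f v * (1 - v\<^sup>2) \<le> K"
    and fMK: "\<And>v w. 0 \<le> v \<Longrightarrow> v \<le> 1 \<Longrightarrow> 0 \<le> w \<Longrightarrow> w \<le> 1 \<Longrightarrow> f v * f w * (1 - (v * w)\<^sup>2) \<le> M * K"
  shows "(\<Prod>i\<in>S. f (ratio (m i) r)) * pair_prod (\<lambda>i j. 1 - (ratio (m i) (m j))\<^sup>2) S
    \<le> M * K ^ (card S - 1)"
  using assms(1) pos
proof (induction "card S" arbitrary: S rule: less_induct)
  case less
  define g where "g i j = 1 - (ratio (m i) (m j))\<^sup>2" for i j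
  have sym: "g i j = g j i" for i j by (simp add: g_def ratio_commute)
  have g01: "0 \<le> g i j \<and> g i j \<le> 1" if "i \<in> S" "j \<in> S" for i j
    using ratio_pos ratio_le_1 less.prems that by (simp add: g_def power_le_one less_imp_le)
  have u01: "0 \<le> ratio (m i) r \<and> ratio (m i) r \<le> 1" if "i \<in> S" for i
    using ratio_pos ratio_le_1 less.prems that r by (simp add: less_imp_le)
  show ?case
  proof (cases "\<exists>i\<in>S. \<exists>j\<in>S. i \<noteq> j \<and> (m i \<le> m j \<and> m j \<le> r \<or> r \<le> m j \<and> m j \<le> m i)")
    case True
    then obtain i j where ij: "i \<in> S" "j \<in> S" "i \<noteq> j"
      "m i \<le> m j \<and> m j \<le> r \<or> r \<le> m j \<and> m j \<le> m i" by blast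
    define S' where "S' = S - {i}"
    have S': "finite S'" "i \<notin> S'" "S = insert i S'" "j \<in> S'"
      using ij less.prems by (auto simp: S'_def)
    define A where "A = (\<Prod>i\<in>S'. f (ratio (m i) r)) * pair_prod g S'"
    have A0: "A \<ge> 0" unfolding A_def using S' g01 u01 f0
      by (intro mult_nonneg_nonneg prod_nonneg pair_prod_nonneg) auto
    have "A \<le> M * K ^ (card S' - 1)"
      using less.hyps[of S'] less.prems S' unfolding A_def g_def by simp
    \<comment> \<open>Of the factors tying \<open>i\<close> to the other elements only the one with
      \<open>j\<close> is kept; the others are at most 1.\<close>
    have "(\<Prod>j\<in>S'. g i j) \<le> g i j" using S' g01 by (intro prod_le_factor) auto
    also have "\<dots> \<le> 1 - (ratio (m i) r)\<^sup>2"
      unfolding g_def using ratio_trans_le[of "m i" "m j" r] ij less.prems r u01[of i]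
      by (simp add: power_mono)
    finally have "f (ratio (m i) r) * (\<Prod>j\<in>S'. g i j) \<le> f (ratio (m i) r) * (1 - (ratio (m i) r)\<^sup>2)"
      using u01[OF ij(1)] f0 by (intro mult_left_mono) auto
    also have "\<dots> \<le> K" using u01[OF ij(1)] fK by auto
    finally have "f (ratio (m i) r) * (\<Prod>j\<in>S'. g i j) * A \<le> K * A"
      using A0 by (rule mult_right_mono)
    also have "\<dots> \<le> K * (M * K ^ (card S' - 1))"
      using K \<open>A \<le> _\<close> by (intro mult_left_mono) auto
    also have "\<dots> = M * K ^ (card S - 1)"
    proof -
      \<comment> \<open>\<open>S'\<close> contains \<open>j\<close>, so the truncated exponent
        really drops by one.\<close>
      have "card S' \<noteq> 0" using S' by auto
      moreover have "card S = Suc (card S')" using S' by simp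
      ultimately have "card S - 1 = Suc (card S' - 1)" by linarith
      then show ?thesis by simp
    qed
    finally show ?thesis
      unfolding A_def g_def[symmetric] using S' by (simp add: pair_prod_insert[OF _ _ sym] mult_ac)
  next
    case False
    define A where "A = {i\<in>S. m i \<le> r}"
    define B where "B = {i\<in>S. \<not> m i \<le> r}"
    have AB: "S = A \<union> B" by (auto simp: A_def B_def)
    have A: "A = {} \<or> (\<exists>i. A = {i})"
    proof -
      have "i = j" if "i \<in> A" "j \<in> A" for i j
        using that False linear[of "m i" "m j"] by (auto simp: A_def)
      then show ?thesis by blast
    qed
    have B: "B = {} \<or> (\<exists>i. B = {i})"
    proof -
      have "i = j" if "i \<in> B" "j \<in> B" for i j
      proof -
        have "r \<le> m i" "r \<le> m j" using that by (auto simp: B_def)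
        then show ?thesis using that False linear[of "m i" "m j"] by (auto simp: B_def)
      qed
      then show ?thesis by blast
    qed
    \<comment> \<open>No element lies between another one and \<open>r\<close>, so each side of
      \<open>r\<close> holds at most one.\<close>
    consider "S = {}" | i where "S = {i}" | i j where "S = {i, j}" "i \<in> A" "j \<in> B"
      using A B unfolding AB by fastforce
    then show ?thesis
    proof cases
      case 1
      then show ?thesis using M by simp
    next
      case 2
      then show ?thesis using fM u01 pair_prod_insert[of "{}" i g] sym
        unfolding g_def[symmetric] by simp
    next
      case 3
      then have ij: "i \<in> S" "j \<in> S" "m i \<le> r" "r < m j" "i \<noteq> j" by (auto simp: A_def B_def)
      \<comment> \<open>\<open>r\<close> separates the two moduli, so logarithmic distances add and
        ratios multiply; \<open>fMK\<close> treats exactly this product.\<close>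
      have "ratio (m i) (m j) = ratio (m i) r * ratio (m j) r"
        using ij r by (simp add: ratio_def)
      then have "g i j = 1 - (ratio (m i) r * ratio (m j) r)\<^sup>2" by (simp add: g_def)
      moreover have "pair_prod g {i, j} = g i j"
        using pair_prod_insert[of "{j}" i g, OF _ _ sym] pair_prod_insert[of "{}" j g, OF _ _ sym] ij by simp
      ultimately show ?thesis
        using fMK[of "ratio (m i) r" "ratio (m j) r"] u01 ij
        unfolding g_def[symmetric] \<open>S = {i, j}\<close> by simp
    qed
  qed
qed

text \<open>A fresh index of modulus \<open>r\<close> joins \<open>G\<close> in
  \<open>prod_opposite_le\<close>. This trades a factor 1 + ratio (m j) r for each \<open>j\<close>
  in \<open>H\<close> against the same factor for each element of \<open>G\<close>; the exponent
  counts the extra charge.\<close>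

lemma prod_opposite_le_with_extra_charge:
  fixes m :: "nat \<Rightarrow> real"
  assumes fin: "finite G" "finite H" and pos: "\<And>i. i \<in> G \<union> H \<Longrightarrow> m i > 0" and r: "r > 0"
  shows "(\<Prod>i\<in>G. \<Prod>j\<in>H. 1 + ratio (m i) (m j)) * (\<Prod>j\<in>H. 1 + ratio (m j) r)
    \<le> 2 ^ min (card G + 1) (card H) * (\<Prod>i\<in>G. 1 + ratio (m i) r)
        * pair_prod (\<lambda>i j. 1 + ratio (m i) (m j)) G * pair_prod (\<lambda>i j. 1 + ratio (m i) (m j)) H"
proof -
  obtain k where k: "k \<notin> G \<union> H"
    using fin ex_new_if_finite[of "G \<union> H"] infinite_UNIV_nat by auto
  define m' where "m' = m(k := r)"
  have m': "m' i = m i" if "i \<in> G \<union> H" for i using that k by (auto simp: m'_def)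
  have mk: "m' k = r" by (simp add: m'_def)
  let ?g = "\<lambda>i j. 1 + ratio (m' i) (m' j)"
  have "(\<Prod>i\<in>insert k G. \<Prod>j\<in>H. ?g i j)
      \<le> 2 ^ min (card (insert k G)) (card H) * pair_prod ?g (insert k G) * pair_prod ?g H"
  proof (rule prod_opposite_le)
    fix i assume "i \<in> insert k G \<union> H"
    then show "m' i > 0" using m' mk pos r by (cases "i = k") auto
  qed (use fin in auto)
  moreover have "(\<Prod>i\<in>insert k G. \<Prod>j\<in>H. ?g i j)
      = (\<Prod>j\<in>H. 1 + ratio (m j) r) * (\<Prod>i\<in>G. \<Prod>j\<in>H. 1 + ratio (m i) (m j))"
    using k fin by (simp add: m' mk ratio_commute[of r])
  moreover have "pair_prod ?g (insert k G)
      = (\<Prod>i\<in>G. 1 + ratio (m i) r) * pair_prod (\<lambda>i j. 1 + ratio (m i) (m j)) G"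
    using k fin m' by (subst pair_prod_insert)
      (auto simp: mk ratio_commute cong: pair_prod_cong)
  moreover have "pair_prod ?g H = pair_prod (\<lambda>i j. 1 + ratio (m i) (m j)) H"
    using m' by (intro pair_prod_cong) auto
  ultimately show ?thesis using k fin by (simp add: mult_ac)
qed

section \<open>The quadratic factors of the conjugate pair\<close>

text \<open>For |c| <= 1 this is |1 + v * exp (i * t)|^2 with cos t = c, the product of the two
  factors of a real number with z and cnj z.\<close>

definition quad :: "real \<Rightarrow> real \<Rightarrow> real" where
  "quad c v = 1 + 2 * c * v + v\<^sup>2"

lemma quad_nonneg:
  assumes "\<bar>c\<bar> \<le> 1"
  shows "0 \<le> quad c v"
proof -
  have "quad c v = (v + c)\<^sup>2 + (1 - c\<^sup>2)" by (simp add: quad_def power2_eq_square algebra_simps)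
  moreover have "c\<^sup>2 \<le> 1" using assms by (simp add: abs_square_le_1)
  ultimately show ?thesis by simp
qed

text \<open>Both sides agree at v = 1 and at w = 1, so (1 - v) * (1 - w) divides the difference; the
  cofactor is nonnegative for |c| <= 1/2.\<close>

lemma quad_mult_le:
  assumes "\<bar>c\<bar> \<le> 1 / 2" "0 \<le> v" "v \<le> 1" "0 \<le> w" "w \<le> 1"
  shows "quad c v * quad c w \<le> (2 + 2 * c) * quad c (v * w)"
proof -
  have cw: "- w \<le> 2 * c * w" using mult_right_mono[of "- 1" "2 * c" w] assms by simp
  have "(2 + 2 * c) * quad c (v * w) - quad c v * quad c w
      = (1 - v) * (1 - w) * ((1 + w + 2 * c) + v * (1 + w + 2 * c * w))"
    by (simp add: quad_def power2_eq_square algebra_simps)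
  also have "\<dots> \<ge> 0"
  proof -
    have "0 \<le> 1 + w + 2 * c" "0 \<le> 1 + w + 2 * c * w" using assms cw by linarith+
    then have "0 \<le> (1 + w + 2 * c) + v * (1 + w + 2 * c * w)"
      using assms(2) mult_nonneg_nonneg[of v "1 + w + 2 * c * w"] by linarith
    then show ?thesis using assms by simp
  qed
  finally show ?thesis by simp
qed

lemma quad_le:
  assumes "\<bar>c\<bar> \<le> 1 / 2" "0 \<le> v" "v \<le> 1"
  shows "quad c v \<le> 2 + 2 * c"
  using quad_mult_le[OF assms, of 0] by (simp add: quad_def)

text \<open>\<open>quad_mult_le\<close> reduces the two-sided condition of
  \<open>cluster_prod_le\<close> to the one-variable bound \<open>K\<close> at v * w.\<close>

lemma cluster_quad_le:
  fixes m :: "'a :: linorder \<Rightarrow> real"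
  assumes "finite S" "\<And>i. i \<in> S \<Longrightarrow> m i > 0" "r > 0" "\<bar>c\<bar> \<le> 1 / 2" "K \<ge> 1"
    and K: "\<And>v. 0 \<le> v \<Longrightarrow> v \<le> 1 \<Longrightarrow> quad c v * (1 - v\<^sup>2) \<le> K"
  shows "(\<Prod>i\<in>S. quad c (ratio (m i) r)) * pair_prod (\<lambda>i j. 1 - (ratio (m i) (m j))\<^sup>2) S
    \<le> (2 + 2 * c) * K ^ (card S - 1)"
proof (rule cluster_prod_le[OF assms(1-3,5)])
  fix v w :: real
  assume v: "0 \<le> v" "v \<le> 1"
  show "0 \<le> quad c v" using assms(4) by (intro quad_nonneg) simp
  show "quad c v \<le> 2 + 2 * c" using assms(4) v by (rule quad_le)
  show "quad c v * (1 - v\<^sup>2) \<le> K" using v by (rule K)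
  assume w: "0 \<le> w" "w \<le> 1"
  have vw: "0 \<le> v * w" "v * w \<le> 1" using v w by (auto intro: mult_le_one)
  have "quad c v * quad c w * (1 - (v * w)\<^sup>2) \<le> (2 + 2 * c) * quad c (v * w) * (1 - (v * w)\<^sup>2)"
    using vw by (intro mult_right_mono quad_mult_le assms(4) v w) (simp add: power_le_one)
  also have "\<dots> = (2 + 2 * c) * (quad c (v * w) * (1 - (v * w)\<^sup>2))" by (simp add: mult_ac)
  also have "\<dots> \<le> (2 + 2 * c) * K" using K[OF vw] assms(4) by (intro mult_left_mono) auto
  finally show "quad c v * quad c w * (1 - (v * w)\<^sup>2) \<le> (2 + 2 * c) * K" .
qed (use assms(4) in auto)

section \<open>Polynomial and trigonometric estimates\<close>

lemma quad_neg_times_le: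
  assumes "0 \<le> c" "0 \<le> v" "v \<le> 1"
  shows "quad (- c) v * (1 - v\<^sup>2) \<le> 1"
proof -
  have v2: "0 \<le> 1 - v\<^sup>2" using assms by (simp add: power_le_one)
  have "quad (- c) v * (1 - v\<^sup>2) \<le> (1 + v\<^sup>2) * (1 - v\<^sup>2)"
    using v2 assms by (intro mult_right_mono) (auto simp: quad_def)
  also have "\<dots> = 1 - (v\<^sup>2)\<^sup>2" by (simp add: power2_eq_square algebra_simps)
  also have "\<dots> \<le> 1" by simp
  finally show ?thesis .
qed

text \<open>Supplies the removal cost for \<open>H\<close>. The slope 0.64 is that of the chord from
  1 at c = 0 to 1.32 at c = 1/2.\<close>

lemma quad_times_le:
  assumes "0 \<le> c" "c \<le> 1 / 2" "0 \<le> v" "v \<le> 1"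
  shows "quad c v * (1 - v\<^sup>2) \<le> 1 + 0.64 * c"
proof -
  \<comment> \<open>\<open>0.455\<close> is close to the maximum of \<open>1 + v - v ^ 3 - v ^ 4\<close>.\<close>
  have "0 \<le> (v - 0.455)\<^sup>2 * (v\<^sup>2 + 1.91 * v + 1.531075)" using assms by simp
  also have "\<dots> = v ^ 3 + v ^ 4 - 0.9978605 * v + 0.316970801875"
    by (simp add: power2_eq_square power3_eq_cube power4_eq_xxxx algebra_simps)
  finally have endpoint: "1 + v - v ^ 3 - v ^ 4 \<le> 1.32" using assms by simp
  \<comment> \<open>The left-hand side is affine in \<open>c\<close>, so it suffices to treat \<open>c = 0\<close> and \<open>c = 1 / 2\<close>.\<close>
  have "quad c v * (1 - v\<^sup>2) = (1 - 2 * c) * (1 - v ^ 4) + 2 * c * (1 + v - v ^ 3 - v ^ 4)"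
    by (simp add: quad_def power2_eq_square power3_eq_cube power4_eq_xxxx algebra_simps)
  also have "\<dots> \<le> (1 - 2 * c) * 1 + 2 * c * 1.32"
    using assms endpoint by (intro add_mono mult_left_mono) auto
  finally show ?thesis by (simp add: algebra_simps)
qed

text \<open>The power s^3 comes from the factor 2 * s of z with cnj z and from (2 - 2 * c) * (2 + 2
  * c) = 4 * s^2 for the two clusters. The coefficient 1.375 is 3/2 - 1/8.\<close>

lemma sin_cubed_le:
  fixes c s :: real
  assumes "0 \<le> c" "c \<le> 1 / 2" "0 \<le> s" "s\<^sup>2 = 1 - c\<^sup>2"
  shows "s ^ 3 \<le> 1 - 1.375 * c\<^sup>2"
proof -
  have "0 \<le> (1 - s)\<^sup>2" by simp
  then have "s \<le> 1 - c\<^sup>2 / 2" using assms(4) by (simp add: power2_eq_square algebra_simps)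
  moreover have c2: "c\<^sup>2 \<le> 1 / 4" using power_mono[OF assms(2,1), of 2] by (simp add: power2_eq_square)
  ultimately have "s * s\<^sup>2 \<le> (1 - c\<^sup>2 / 2) * (1 - c\<^sup>2)"
    unfolding assms(4) by (intro mult_right_mono) auto
  also have "\<dots> = 1 - 3 / 2 * c\<^sup>2 + 1 / 2 * (c\<^sup>2 * c\<^sup>2)"
    by (simp add: power2_eq_square field_simps)
  also have "\<dots> \<le> 1 - 3 / 2 * c\<^sup>2 + 1 / 2 * (1 / 4 * c\<^sup>2)"
    using c2 by (intro add_mono mult_left_mono mult_right_mono) auto
  finally show ?thesis by (simp add: power2_eq_square power3_eq_cube mult_ac)
qed

lemma sin_cubed_times_le:
  fixes c s :: real
  assumes "0 \<le> c" "c \<le> 1 / 2" "0 \<le> s" "s\<^sup>2 = 1 - c\<^sup>2"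
  shows "s ^ 3 * (1 + 0.64 * c) \<le> 1.09" and "s ^ 3 * (1 + 0.64 * c)\<^sup>2 \<le> 1.25"
proof -
  note s3 = sin_cubed_le[OF assms]
  have "s ^ 3 * (1 + 0.64 * c) \<le> (1 - 1.375 * c\<^sup>2) * (1 + 0.64 * c)"
    using s3 assms by (intro mult_right_mono) auto
  \<comment> \<open>64/275 is the vertex of 0.64 * c - 1.375 * c^2, and 0.4096 / 5.5 is its
    maximum.\<close>
  also have "\<dots> = 1.09 - (1.375 * (c - 64 / 275)\<^sup>2 + 0.88 * c ^ 3) - (0.09 - 0.4096 / 5.5)"
    by (simp add: power2_eq_square power3_eq_cube field_simps)
  also have "\<dots> \<le> 1.09 - 0 - (0.09 - 0.4096 / 5.5)"
    using assms by (intro diff_mono add_nonneg_nonneg) auto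
  also have "\<dots> \<le> 1.09" by simp
  finally show "s ^ 3 * (1 + 0.64 * c) \<le> 1.09" .
  have "s ^ 3 * (1 + 0.64 * c)\<^sup>2 \<le> (1 - 1.375 * c\<^sup>2) * (1 + 0.64 * c)\<^sup>2"
    using s3 by (intro mult_right_mono) auto
  \<comment> \<open>Division by \<open>(c - 0.328)\<^sup>2\<close>, where \<open>0.328\<close> is close to the maximum.\<close>
  also have "\<dots> = 1.25 - (c - 0.328)\<^sup>2 * (0.5632 * c\<^sup>2 + 2.1294592 * c + 2.3017339264)
      - (0.0008417171456 * c + 0.0023702572621824)"
    by algebra
  also have "\<dots> \<le> 1.25 - 0 - 0"
    using assms by (intro diff_mono add_nonneg_nonneg mult_nonneg_nonneg) auto
  also have "\<dots> = 1.25" by simp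
  finally show "s ^ 3 * (1 + 0.64 * c)\<^sup>2 \<le> 1.25" .
qed

text \<open>The square (1 - c) * (1 + c)^3 has maximum 27/16 = 1.6875 at c = 1/2, the double root in
  the proof; 1.3^2 is 1.69.\<close>

lemma sin_times_one_plus_cos_le:
  fixes c s :: real
  assumes "0 \<le> c" "0 \<le> s" "s\<^sup>2 = 1 - c\<^sup>2"
  shows "s * (1 + c) \<le> 1.3"
proof (rule power2_le_imp_le)
  have "0 \<le> (c - 1 / 2)\<^sup>2 * (c\<^sup>2 + 3 * c + 2.75)" using assms by simp
  moreover have "(s * (1 + c))\<^sup>2 = 1.6875 - (c - 1 / 2)\<^sup>2 * (c\<^sup>2 + 3 * c + 2.75)"
    by (simp add: power_mult_distrib assms(3)) (simp add: power2_eq_square field_simps)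
  ultimately show "(s * (1 + c))\<^sup>2 \<le> 1.3\<^sup>2" by (simp add: power2_eq_square)
qed simp

section \<open>Real numbers around the pair, for small and for large cosine\<close>

lemma pair_prod_one_minus_square:
  "pair_prod (\<lambda>i j. 1 - t i j) S * pair_prod (\<lambda>i j. 1 + t i j) S = pair_prod (\<lambda>i j. 1 - (t i j)\<^sup>2) S"
  unfolding pair_prod_mult[symmetric] by (simp add: power2_eq_square algebra_simps)

text \<open>Once \<open>prod_opposite_le\<close> has removed the mixed factors, the clusters
  separate: removal costs 1 in \<open>G\<close> and 1 + 0.64 * c in \<open>H\<close>.\<close>

lemma config_le_small_cos:
  fixes m :: "nat \<Rightarrow> real"
  assumes fin: "finite G" "finite H" and pos: "\<And>i. i \<in> G \<union> H \<Longrightarrow> m i > 0" and r: "r > 0"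
    and c: "0 \<le> c" "c \<le> 1 / 2"
  shows "(\<Prod>i\<in>G. quad (- c) (ratio (m i) r)) * (\<Prod>i\<in>H. quad c (ratio (m i) r))
     * (pair_prod (\<lambda>i j. 1 - ratio (m i) (m j)) G * pair_prod (\<lambda>i j. 1 - ratio (m i) (m j)) H
       * (\<Prod>i\<in>G. \<Prod>j\<in>H. 1 + ratio (m i) (m j)))
    \<le> 2 ^ min (card G) (card H) * (4 * (1 - c\<^sup>2) * (1 + 0.64 * c) ^ (card H - 1))"
proof -
  let ?M = "\<lambda>S. pair_prod (\<lambda>i j. 1 - ratio (m i) (m j)) S"
  let ?P = "\<lambda>S. pair_prod (\<lambda>i j. 1 + ratio (m i) (m j)) S"
  let ?S = "\<lambda>S. pair_prod (\<lambda>i j. 1 - (ratio (m i) (m j))\<^sup>2) S"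
  let ?A = "\<Prod>i\<in>G. quad (- c) (ratio (m i) r)"
  let ?B = "\<Prod>i\<in>H. quad c (ratio (m i) r)"
  let ?N = "2 ^ min (card G) (card H) :: real"
  have t: "0 \<le> ratio (m i) (m j)" "ratio (m i) (m j) \<le> 1" if "i \<in> G \<union> H" "j \<in> G \<union> H" for i j
    using ratio_pos ratio_le_1 pos[OF that(1)] pos[OF that(2)] by (simp_all add: less_imp_le)
  have A0: "?A \<ge> 0" and B0: "?B \<ge> 0" using c by (auto intro!: prod_nonneg quad_nonneg)
  have M0: "?M G \<ge> 0" "?M H \<ge> 0" using t by (auto intro!: pair_prod_nonneg)
  have S0: "?S G \<ge> 0" "?S H \<ge> 0" using t by (auto intro!: pair_prod_nonneg simp: power_le_one)
  have "(\<Prod>i\<in>G. \<Prod>j\<in>H. 1 + ratio (m i) (m j)) \<le> ?N * ?P G * ?P H"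
    using fin pos by (rule prod_opposite_le)
  then have "?A * ?B * (?M G * ?M H * (\<Prod>i\<in>G. \<Prod>j\<in>H. 1 + ratio (m i) (m j)))
      \<le> ?A * ?B * (?M G * ?M H * (?N * ?P G * ?P H))"
    using A0 B0 M0 by (intro mult_left_mono mult_nonneg_nonneg)
  also have "\<dots> = ?N * ((?A * (?M G * ?P G)) * (?B * (?M H * ?P H)))" by (simp add: mult_ac)
  also have "\<dots> = ?N * ((?A * ?S G) * (?B * ?S H))" by (simp only: pair_prod_one_minus_square)
  also have "\<dots> \<le> ?N * (((2 + 2 * - c) * 1 ^ (card G - 1)) * ((2 + 2 * c) * (1 + 0.64 * c) ^ (card H - 1)))"
  proof -
    have "?A * ?S G \<le> (2 + 2 * - c) * 1 ^ (card G - 1)"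
      using fin pos r c quad_neg_times_le[OF c(1)] by (intro cluster_quad_le) auto
    moreover have "?B * ?S H \<le> (2 + 2 * c) * (1 + 0.64 * c) ^ (card H - 1)"
      using fin pos r c quad_times_le[OF c] by (intro cluster_quad_le) auto
    ultimately show ?thesis
      by (rule mult_left_mono[OF mult_mono]) (use B0 S0 c in auto)
  qed
  also have "\<dots> = ?N * (4 * (1 - c\<^sup>2) * (1 + 0.64 * c) ^ (card H - 1))"
    by (simp add: power2_eq_square algebra_simps)
  finally show ?thesis .
qed

text \<open>The extra charge contributes 1 + v. For c >= 1/2 the factor is at most (1 - v + v^2) *
  (1 + v) = 1 + v^3, and removal still costs only 1.\<close>

lemma cluster_extra_charge_positive:
  fixes m :: "'a :: linorder \<Rightarrow> real"
  assumes "finite S" "\<And>i. i \<in> S \<Longrightarrow> m i > 0" "r > 0" and c: "1 / 2 \<le> c" "c \<le> 1"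
  shows "(\<Prod>i\<in>S. quad (- c) (ratio (m i) r) * (1 + ratio (m i) r))
    * pair_prod (\<lambda>i j. 1 - (ratio (m i) (m j))\<^sup>2) S \<le> 2"
proof -
  define f where "f v = quad (- c) v * (1 + v)" for v
  have f0: "0 \<le> f v" if "0 \<le> v" for v
    using that c quad_nonneg[of "- c" v] by (simp add: f_def)
  have f3: "f v \<le> 1 + v ^ 3" if "0 \<le> v" for v
  proof -
    have "quad (- c) v \<le> 1 - v + v\<^sup>2" using c mult_right_mono[of 1 "2 * c" v] that by (simp add: quad_def)
    then have "f v \<le> (1 - v + v\<^sup>2) * (1 + v)" unfolding f_def using that by (intro mult_right_mono) auto
    then show ?thesis by (simp add: power2_eq_square power3_eq_cube algebra_simps)
  qed
  have v3: "v ^ 3 \<le> v\<^sup>2" if "0 \<le> v" "v \<le> 1" for v :: real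
    using that by (intro power_decreasing) auto
  have "(\<Prod>i\<in>S. f (ratio (m i) r)) * pair_prod (\<lambda>i j. 1 - (ratio (m i) (m j))\<^sup>2) S
      \<le> 2 * 1 ^ (card S - 1)"
  proof (rule cluster_prod_le[OF assms(1-3)])
    fix v w :: real
    assume v: "0 \<le> v" "v \<le> 1"
    show "0 \<le> f v" using v f0 by auto
    show "f v \<le> 2" using f3[of v] v power_le_one[of v 3] by linarith
    have v2: "v\<^sup>2 \<le> 1" using v by (simp add: power_le_one)
    have "f v * (1 - v\<^sup>2) \<le> (1 + v\<^sup>2) * (1 - v\<^sup>2)"
      using f3[of v] v3[of v] v v2 by (intro mult_right_mono) linarith+
    also have "\<dots> = 1 - (v\<^sup>2)\<^sup>2" by (simp add: power2_eq_square algebra_simps)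
    also have "\<dots> \<le> 1" by simp
    finally show "f v * (1 - v\<^sup>2) \<le> 1" .
    assume w: "0 \<le> w" "w \<le> 1"
    define a b where "a = v\<^sup>2" and "b = w\<^sup>2"
    have ab: "0 \<le> a" "a \<le> 1" "0 \<le> b" "b \<le> 1" using v w by (auto simp: a_def b_def power_le_one)
    have ab1: "a * b \<le> 1" using ab by (intro mult_le_one) auto
    \<comment> \<open>Weakening v^3 to v^2 leaves only squares; then (1 - a) * (1 - b) >= 0 brings
      in 1 + a * b, to be paired with 1 - a * b.\<close>
    have "f v * f w \<le> (1 + a) * (1 + b)"
      using f3[of v] v3[of v] f3[of w] v3[of w] f0 v w ab
      unfolding a_def b_def by (intro mult_mono) auto
    also have "\<dots> \<le> 2 * (1 + a * b)"
      using mult_nonneg_nonneg[of "1 - a" "1 - b"] ab by (simp add: algebra_simps)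
    finally have "f v * f w * (1 - a * b) \<le> 2 * (1 + a * b) * (1 - a * b)"
      using ab1 by (intro mult_right_mono) auto
    also have "\<dots> = 2 - 2 * (a * b)\<^sup>2" by (simp add: power2_eq_square algebra_simps)
    also have "\<dots> \<le> 2 * 1" by simp
    finally have "f v * f w * (1 - a * b) \<le> 2 * 1" .
    then show "f v * f w * (1 - (v * w)\<^sup>2) \<le> 2 * 1" by (simp add: a_def b_def power_mult_distrib)
  qed auto
  then show ?thesis by (simp add: f_def)
qed

text \<open>Without the factor 1 + v taken by the extra charge, each quadratic is at most 1 + c * v.
  The cost 32/27 is the maximum of (1 + v) * (1 - v^2), at v = 1/3.\<close>

lemma cluster_extra_charge_negative:
  fixes m :: "'a :: linorder \<Rightarrow> real"
  assumes "finite S" "\<And>i. i \<in> S \<Longrightarrow> m i > 0" "r > 0" and c: "0 \<le> c" "c \<le> 1"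
  shows "(\<Prod>i\<in>S. quad c (ratio (m i) r) / (1 + ratio (m i) r))
    * pair_prod (\<lambda>i j. 1 - (ratio (m i) (m j))\<^sup>2) S \<le> (1 + c) * (32 / 27) ^ (card S - 1)"
proof (rule cluster_prod_le[OF assms(1-3)])
  have f1: "quad c v / (1 + v) \<le> 1 + c * v" if "0 \<le> v" "v \<le> 1" for v
  proof -
    have "0 \<le> (1 - c) * (v * (1 - v))" using that c by simp
    then have "quad c v \<le> (1 + c * v) * (1 + v)"
      by (simp add: quad_def power2_eq_square algebra_simps)
    then show ?thesis using that by (simp add: pos_divide_le_eq)
  qed
  have K: "(1 + c * v) * (1 - v\<^sup>2) \<le> 32 / 27" if "0 \<le> v" "v \<le> 1" for v
  proof -
    have "(1 + c * v) * (1 - v\<^sup>2) \<le> (1 + v) * (1 - v\<^sup>2)"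
      using that c mult_right_mono[of c 1 v] by (intro mult_right_mono) (auto simp: power_le_one)
    also have "\<dots> = 32 / 27 - (v - 1 / 3)\<^sup>2 * (v + 5 / 3)"
      by (simp add: power2_eq_square field_simps)
    also have "\<dots> \<le> 32 / 27" using that by simp
    finally show ?thesis .
  qed
  fix v w :: real
  assume v: "0 \<le> v" "v \<le> 1"
  show "0 \<le> quad c v / (1 + v)" using v c quad_nonneg[of c v] by simp
  show "quad c v / (1 + v) \<le> 1 + c" using f1[OF v] v c mult_left_le[of v c] by linarith
  have "quad c v / (1 + v) * (1 - v\<^sup>2) \<le> (1 + c * v) * (1 - v\<^sup>2)"
    using f1[OF v] v by (intro mult_right_mono) (auto simp: power_le_one)
  then show "quad c v / (1 + v) * (1 - v\<^sup>2) \<le> 32 / 27" using K[OF v] by linarith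
  assume w: "0 \<le> w" "w \<le> 1"
  have vw: "0 \<le> v * w" "v * w \<le> 1" using v w by (auto intro: mult_le_one)
  have "quad c v / (1 + v) * (quad c w / (1 + w)) \<le> (1 + c * v) * (1 + c * w)"
    using f1[OF v] f1[OF w] v w c quad_nonneg[of c w] by (intro mult_mono) auto
  also have "\<dots> \<le> (1 + c) * (1 + c * (v * w))"
  proof -
    have "0 \<le> c * ((1 - v) * (1 - w))" using v w c by simp
    then show ?thesis by (simp add: algebra_simps)
  qed
  finally have "quad c v / (1 + v) * (quad c w / (1 + w)) * (1 - (v * w)\<^sup>2)
      \<le> (1 + c) * (1 + c * (v * w)) * (1 - (v * w)\<^sup>2)"
    using vw by (intro mult_right_mono) (auto simp: power_le_one)
  also have "\<dots> = (1 + c) * ((1 + c * (v * w)) * (1 - (v * w)\<^sup>2))" by (simp only: mult.assoc)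
  also have "\<dots> \<le> (1 + c) * (32 / 27)" using K[OF vw] c by (intro mult_left_mono) auto
  finally show "quad c v / (1 + v) * (quad c w / (1 + w)) * (1 - (v * w)\<^sup>2) \<le> (1 + c) * (32 / 27)" .
qed (use c in auto)

text \<open>At c = 1, \<open>quad c v\<close> is (1 + v)^2, as for a double charge at
  \<open>r\<close>. Splitting off one factor 1 + v lowers the removal cost in \<open>H\<close> to
  32/27, at the price of a possibly larger power of 2.\<close>

lemma config_le_large_cos:
  fixes m :: "nat \<Rightarrow> real"
  assumes fin: "finite G" "finite H" and pos: "\<And>i. i \<in> G \<union> H \<Longrightarrow> m i > 0" and r: "r > 0"
    and c: "1 / 2 \<le> c" "c \<le> 1"
  shows "(\<Prod>i\<in>G. quad (- c) (ratio (m i) r)) * (\<Prod>i\<in>H. quad c (ratio (m i) r))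
     * (pair_prod (\<lambda>i j. 1 - ratio (m i) (m j)) G * pair_prod (\<lambda>i j. 1 - ratio (m i) (m j)) H
       * (\<Prod>i\<in>G. \<Prod>j\<in>H. 1 + ratio (m i) (m j)))
    \<le> 2 ^ min (card G + 1) (card H) * (2 * ((1 + c) * (32 / 27) ^ (card H - 1)))"
proof -
  let ?M = "\<lambda>S. pair_prod (\<lambda>i j. 1 - ratio (m i) (m j)) S"
  let ?P = "\<lambda>S. pair_prod (\<lambda>i j. 1 + ratio (m i) (m j)) S"
  let ?S = "\<lambda>S. pair_prod (\<lambda>i j. 1 - (ratio (m i) (m j))\<^sup>2) S"
  let ?A = "\<Prod>i\<in>G. quad (- c) (ratio (m i) r)"
  let ?B = "\<Prod>i\<in>H. quad c (ratio (m i) r) / (1 + ratio (m i) r)"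
  let ?X = "\<Prod>i\<in>H. 1 + ratio (m i) r"
  let ?Y = "\<Prod>i\<in>G. 1 + ratio (m i) r"
  let ?Z = "\<Prod>i\<in>G. \<Prod>j\<in>H. 1 + ratio (m i) (m j)"
  let ?N = "2 ^ min (card G + 1) (card H) :: real"
  have t: "0 \<le> ratio (m i) (m j)" "ratio (m i) (m j) \<le> 1" if "i \<in> G \<union> H" "j \<in> G \<union> H" for i j
    using ratio_pos ratio_le_1 pos[OF that(1)] pos[OF that(2)] by (simp_all add: less_imp_le)
  have u: "0 < ratio (m i) r" if "i \<in> G \<union> H" for i
    using ratio_pos pos[OF that] r by simp
  have A0: "?A \<ge> 0" using c by (auto intro!: prod_nonneg quad_nonneg)
  have B0: "?B \<ge> 0" using c u by (intro prod_nonneg ballI divide_nonneg_nonneg quad_nonneg)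
    (auto simp: less_imp_le add_nonneg_nonneg)
  have M0: "?M G \<ge> 0" "?M H \<ge> 0" using t by (auto intro!: pair_prod_nonneg)
  have S0: "?S G \<ge> 0" "?S H \<ge> 0" using t by (auto intro!: pair_prod_nonneg simp: power_le_one)
  have "(\<Prod>i\<in>H. quad c (ratio (m i) r)) = ?B * ?X"
  proof -
    have "1 + ratio (m i) r \<noteq> 0" if "i \<in> H" for i using u[of i] that by auto
    then show ?thesis unfolding prod.distrib[symmetric] by (intro prod.cong) auto
  qed
  then have "?A * (\<Prod>i\<in>H. quad c (ratio (m i) r)) * (?M G * ?M H * ?Z)
      = ?A * ?B * (?M G * ?M H * (?Z * ?X))" by (simp add: mult_ac)
  also have "\<dots> \<le> ?A * ?B * (?M G * ?M H * (?N * ?Y * ?P G * ?P H))"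
    using A0 B0 M0 prod_opposite_le_with_extra_charge[OF fin pos r]
    by (intro mult_left_mono mult_nonneg_nonneg)
  also have "\<dots> = ?N * ((?A * ?Y * (?M G * ?P G)) * (?B * (?M H * ?P H)))" by (simp add: mult_ac)
  also have "\<dots> = ?N * ((?A * ?Y * ?S G) * (?B * ?S H))" by (simp only: pair_prod_one_minus_square)
  also have "\<dots> \<le> ?N * (2 * ((1 + c) * (32 / 27) ^ (card H - 1)))"
  proof -
    have "?A * ?Y * ?S G \<le> 2"
      unfolding prod.distrib[symmetric] using fin pos r c by (intro cluster_extra_charge_positive) auto
    moreover have "?B * ?S H \<le> (1 + c) * (32 / 27) ^ (card H - 1)"
      using fin pos r c by (intro cluster_extra_charge_negative) auto
    ultimately show ?thesis
      by (rule mult_left_mono[OF mult_mono]) (use B0 S0 in auto)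
  qed
  finally show ?thesis .
qed

section \<open>From admissible tuples to modulus ratios\<close>

lemma same_sign_factor:
  assumes "a * b > 0"
  shows "\<bar>a - b\<bar> / max \<bar>a\<bar> \<bar>b\<bar> = 1 - ratio \<bar>a\<bar> \<bar>b\<bar>"
  using assms by (auto simp: ratio_def zero_less_mult_iff max_def min_def abs_if field_simps)

lemma opposite_sign_factor:
  assumes "a * b < 0"
  shows "\<bar>a - b\<bar> / max \<bar>a\<bar> \<bar>b\<bar> = 1 + ratio \<bar>a\<bar> \<bar>b\<bar>"
  using assms by (auto simp: ratio_def mult_less_0_iff max_def min_def abs_if field_simps)

lemma quad_ratio:
  assumes "m > 0" "r > 0"
  shows "(m\<^sup>2 + 2 * m * (c * r) + r\<^sup>2) / (max m r)\<^sup>2 = quad c (ratio m r)"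
  using assms by (auto simp: quad_def ratio_def max_def min_def power2_eq_square field_simps)

lemma admissible_one_pair:
  assumes "admissible n 1 y"
  obtains a b where "a \<in> {1..n}" "b \<in> {1..n}" "a \<noteq> b" "y a \<notin> \<real>" "y b = cnj (y a)"
    "\<forall>i\<in>{1..n} - {a, b}. y i \<in> \<real>"
proof -
  from assms obtain a b :: "nat \<Rightarrow> nat" where
    "a ` {1..1} \<inter> b ` {1..1} = {}" "a ` {1..1} \<union> b ` {1..1} \<subseteq> {1..n}"
    "\<forall>k\<in>{1..1}. y (a k) \<notin> \<real> \<and> y (b k) = cnj (y (a k))"
    "\<forall>i\<in>{1..n} - (a ` {1..1} \<union> b ` {1..1}). y i \<in> \<real>"
    unfolding admissible_def by blast
  then show ?thesis by (intro that[of "a 1" "b 1"]) auto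
qed

lemma admissible_cmod_mono:
  assumes "admissible n r2 y" "1 \<le> i" "i \<le> j" "j \<le> n"
  shows "cmod (y i) \<le> cmod (y j)"
  using assms(3,4)
proof (induction j rule: dec_induct)
  case (step j)
  then have "cmod (y j) \<le> cmod (y (j + 1))"
    using assms(1,2) unfolding admissible_def by auto
  with step show ?case by simp
qed simp

lemma admissible_cmod_pos:
  assumes "admissible n r2 y" "1 \<le> i" "i \<le> n"
  shows "0 < cmod (y i)"
proof -
  have "0 < cmod (y 1)" using assms(1) by (simp add: admissible_def)
  then show ?thesis using admissible_cmod_mono[OF assms(1) order_refl assms(2,3)] by (rule less_le_trans)
qed

definition normalized_dist :: "complex \<Rightarrow> complex \<Rightarrow> real" where
  "normalized_dist w z = cmod (w - z) / max (cmod w) (cmod z)"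

lemma normalized_dist_commute: "normalized_dist w z = normalized_dist z w"
  by (simp add: normalized_dist_def norm_minus_commute max.commute)

lemma pohst_prod_eq_pair_prod:
  assumes "admissible n r2 y"
  shows "pohst_prod n y = pair_prod (\<lambda>i j. normalized_dist (y i) (y j)) {1..n}"
proof -
  have "pohst_prod n y = pair_prod (\<lambda>i j. cmod (1 - y i / y j)) {1..n}"
    unfolding pohst_prod_def pair_prod_def by (intro prod.cong) auto
  also have "\<dots> = pair_prod (\<lambda>i j. normalized_dist (y i) (y j)) {1..n}"
  proof (rule pair_prod_cong)
    fix i j :: nat
    assume "i \<in> {1..n}" "j \<in> {1..n}" "i < j"
    then have le: "cmod (y i) \<le> cmod (y j)" and nz: "y j \<noteq> 0"
      using admissible_cmod_mono[OF assms, of i j] admissible_cmod_pos[OF assms, of j] by auto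
    have "1 - y i / y j = (y j - y i) / y j" using nz by (simp add: field_simps)
    then have "cmod (1 - y i / y j) = cmod (y j - y i) / cmod (y j)" by (simp add: norm_divide)
    then show "cmod (1 - y i / y j) = normalized_dist (y i) (y j)"
      using le by (simp add: normalized_dist_def norm_minus_commute)
  qed
  finally show ?thesis .
qed

text \<open>Here \<open>c\<close> and \<open>s\<close> are the absolute values of cosine and sine of the argument of the
  non-real pair, \<open>G\<close> the indices of the real numbers on the same side as its real part.\<close>

lemma pohst_prod_config:
  assumes adm: "admissible n 1 y"
  obtains G H c s and m :: "nat \<Rightarrow> real" and r where
    "finite G" "finite H" "card G + card H = n - 2" "0 \<le> c" "c \<le> 1" "0 \<le> s" "s\<^sup>2 = 1 - c\<^sup>2"
    "\<forall>i\<in>G \<union> H. m i > 0" "r > 0"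
    "pohst_prod n y = 2 * s *
     ((\<Prod>i\<in>G. quad (- c) (ratio (m i) r)) * (\<Prod>i\<in>H. quad c (ratio (m i) r))
     * (pair_prod (\<lambda>i j. 1 - ratio (m i) (m j)) G * pair_prod (\<lambda>i j. 1 - ratio (m i) (m j)) H
       * (\<Prod>i\<in>G. \<Prod>j\<in>H. 1 + ratio (m i) (m j))))"
proof -
  obtain a b where ab: "a \<in> {1..n}" "b \<in> {1..n}" "a \<noteq> b" "y a \<notin> \<real>" "y b = cnj (y a)"
    and real: "\<forall>i\<in>{1..n} - {a, b}. y i \<in> \<real>"
    by (rule admissible_one_pair[OF adm])
  define z where "z = y a"
  define r where "r = cmod z"
  \<comment> \<open>Reflects the tuple so that the pair gets a nonnegative real part.\<close>
  define \<sigma> :: real where "\<sigma> = (if Re z \<ge> 0 then 1 else - 1)"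
  define X where "X i = \<sigma> * Re (y i)" for i
  define m where "m i = \<bar>X i\<bar>" for i
  define c where "c = \<bar>Re z\<bar> / r"
  define s where "s = \<bar>Im z\<bar> / r"
  define R where "R = {1..n} - {a, b}"
  define G where "G = {i \<in> R. X i > 0}"
  define H where "H = {i \<in> R. X i < 0}"
  define D where "D i j = normalized_dist (y i) (y j)" for i j
  have sym: "D i j = D j i" for i j by (simp add: D_def normalized_dist_commute)
  have \<sigma>: "\<bar>\<sigma>\<bar> = 1" "\<sigma> * \<sigma> = 1" "\<sigma> * Re z = \<bar>Re z\<bar>" by (auto simp: \<sigma>_def)
  have r: "r > 0" using admissible_cmod_pos[OF adm] ab(1) by (auto simp: r_def z_def)
  have Im0: "Im (y i) = 0" if "i \<in> R" for i
    using real that by (simp add: R_def complex_is_Real_iff)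
  have mR: "cmod (y i) = m i" if "i \<in> R" for i
    using Im0[OF that] \<sigma>(1) by (simp add: cmod_eq_Re m_def X_def abs_mult)
  have mpos: "m i > 0" if "i \<in> R" for i
    using admissible_cmod_pos[OF adm, of i] that mR[OF that] by (simp add: R_def)
  have GR: "i \<in> R" "X i > 0" if "i \<in> G" for i using that by (auto simp: G_def)
  have HR: "i \<in> R" "X i < 0" if "i \<in> H" for i using that by (auto simp: H_def)
  have R: "R = G \<union> H"
  proof (intro equalityI subsetI)
    fix i assume "i \<in> R"
    moreover from this have "X i \<noteq> 0" using mpos[of i] by (auto simp: m_def)
    ultimately show "i \<in> G \<union> H" by (auto simp: G_def H_def)
  qed (use GR HR in auto)
  have disj: "G \<inter> H = {}" using GR HR by fastforce
  have fin: "finite G" "finite H" by (auto simp: G_def H_def R_def)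
  have DR: "D i j = \<bar>X i - X j\<bar> / max \<bar>X i\<bar> \<bar>X j\<bar>" if "i \<in> R" "j \<in> R" for i j
  proof -
    have "cmod (y i - y j) = \<bar>Re (y i) - Re (y j)\<bar>"
      using Im0 that by (simp add: cmod_eq_Re)
    also have "\<dots> = \<bar>X i - X j\<bar>"
      unfolding X_def right_diff_distrib[symmetric] abs_mult using \<sigma>(1) by simp
    finally show ?thesis using that by (simp add: D_def normalized_dist_def mR m_def)
  qed
  have Dsame: "D i j = 1 - ratio (m i) (m j)" if "i \<in> R" "j \<in> R" "X i * X j > 0" for i j
    using DR[OF that(1,2)] same_sign_factor[OF that(3)] by (simp add: m_def)
  have Dopp: "D i j = 1 + ratio (m i) (m j)" if "i \<in> G" "j \<in> H" for i j
  proof -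
    have "X i * X j < 0" using GR(2)[OF that(1)] HR(2)[OF that(2)] by (rule mult_pos_neg)
    then show ?thesis
      using DR[OF GR(1)[OF that(1)] HR(1)[OF that(2)]] opposite_sign_factor by (simp add: m_def)
  qed
  \<comment> \<open>A real number is equidistant from z and cnj z, so the two factors form a square,
    expanded by the law of cosines.\<close>
  have DD: "D i a * D i b = ((X i)\<^sup>2 - 2 * X i * (c * r) + r\<^sup>2) / (max (m i) r)\<^sup>2" if "i \<in> R" for i
  proof -
    have "cmod (y i - cnj z) = cmod (y i - z)"
      using Im0[OF that] by (simp add: cmod_def)
    then have "D i a * D i b = (cmod (y i - z))\<^sup>2 / (max (m i) r)\<^sup>2"
      using that ab by (simp add: D_def normalized_dist_def mR z_def r_def power2_eq_square)
    also have "(cmod (y i - z))\<^sup>2 = (Re (y i) - Re z)\<^sup>2 + (Im z)\<^sup>2"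
      using Im0[OF that] by (simp add: cmod_power2)
    also have "\<dots> = (Re (y i))\<^sup>2 - 2 * (Re (y i) * Re z) + r\<^sup>2"
      unfolding r_def cmod_power2 by (simp add: power2_eq_square algebra_simps)
    also have "(Re (y i))\<^sup>2 = (X i)\<^sup>2"
      using \<sigma>(2) by (simp add: X_def power2_eq_square mult_ac)
    also have "Re (y i) * Re z = X i * (c * r)"
    proof -
      have "X i * (c * r) = \<sigma> * Re (y i) * (\<sigma> * Re z)" using r by (simp add: X_def c_def \<sigma>(3))
      also have "\<dots> = (\<sigma> * \<sigma>) * (Re (y i) * Re z)" by (simp only: mult_ac)
      finally show ?thesis using \<sigma>(2) by simp
    qed
    finally show ?thesis by (simp add: mult_ac)
  qed
  \<comment> \<open>\<open>X i\<close> is \<open>m i\<close> on \<open>G\<close> and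
    \<open>- m i\<close> on \<open>H\<close>; this decides the sign of the linear term.\<close>
  have DG: "D i a * D i b = quad (- c) (ratio (m i) r)" if "i \<in> G" for i
    using DD[OF GR(1)[OF that]] quad_ratio[OF mpos[OF GR(1)[OF that]] r, of "- c"] GR(2)[OF that]
    by (simp add: m_def)
  have DH: "D i a * D i b = quad c (ratio (m i) r)" if "i \<in> H" for i
    using DD[OF HR(1)[OF that]] quad_ratio[OF mpos[OF HR(1)[OF that]] r, of c] HR(2)[OF that]
    by (simp add: m_def)
  have Dab: "D a b = 2 * s"
  proof -
    have "cmod (z - cnj z) = 2 * \<bar>Im z\<bar>" by (simp add: complex_diff_cnj norm_mult)
    then show ?thesis using ab(5) by (simp add: D_def normalized_dist_def s_def r_def z_def)
  qed
  have "pohst_prod n y = pair_prod D {1..n}"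
    unfolding pohst_prod_eq_pair_prod[OF adm] D_def ..
  also have "{1..n} = R \<union> {a, b}" using ab by (auto simp: R_def)
  also have "pair_prod D \<dots> = pair_prod D R * pair_prod D {a, b} * (\<Prod>i\<in>R. \<Prod>j\<in>{a, b}. D i j)"
    by (intro pair_prod_Un sym) (auto simp: R_def)
  also have "pair_prod D {a, b} = 2 * s"
    using ab(3) Dab pair_prod_insert[of "{b}" a D, OF _ _ sym] pair_prod_insert[of "{}" b D, OF _ _ sym]
    by simp
  also have "(\<Prod>i\<in>R. \<Prod>j\<in>{a, b}. D i j)
      = (\<Prod>i\<in>G. quad (- c) (ratio (m i) r)) * (\<Prod>i\<in>H. quad c (ratio (m i) r))"
    using ab(3) DG DH fin disj unfolding R by (simp add: prod.union_disjoint)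
  also have "pair_prod D R = pair_prod D G * pair_prod D H * (\<Prod>i\<in>G. \<Prod>j\<in>H. D i j)"
    unfolding R by (intro pair_prod_Un fin disj sym)
  also have "pair_prod D G = pair_prod (\<lambda>i j. 1 - ratio (m i) (m j)) G"
    by (intro pair_prod_cong Dsame) (auto simp: GR)
  also have "pair_prod D H = pair_prod (\<lambda>i j. 1 - ratio (m i) (m j)) H"
    by (intro pair_prod_cong Dsame) (auto simp: HR mult_neg_neg)
  also have "(\<Prod>i\<in>G. \<Prod>j\<in>H. D i j) = (\<Prod>i\<in>G. \<Prod>j\<in>H. 1 + ratio (m i) (m j))"
    using Dopp by simp
  finally have P: "pohst_prod n y = 2 * s *
     ((\<Prod>i\<in>G. quad (- c) (ratio (m i) r)) * (\<Prod>i\<in>H. quad c (ratio (m i) r))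
     * (pair_prod (\<lambda>i j. 1 - ratio (m i) (m j)) G * pair_prod (\<lambda>i j. 1 - ratio (m i) (m j)) H
       * (\<Prod>i\<in>G. \<Prod>j\<in>H. 1 + ratio (m i) (m j))))"
    by (simp add: mult_ac)
  have card: "card G + card H = n - 2"
  proof -
    have "card G + card H = card R" using fin disj unfolding R by (simp add: card_Un_disjoint)
    also have "\<dots> = n - 2" unfolding R_def using ab by (subst card_Diff_subset) auto
    finally show ?thesis .
  qed
  have c: "0 \<le> c" "c \<le> 1" using r abs_Re_le_cmod[of z] by (auto simp: c_def r_def)
  have s: "0 \<le> s" using r by (simp add: s_def)
  have "c\<^sup>2 + s\<^sup>2 = ((Re z)\<^sup>2 + (Im z)\<^sup>2) / r\<^sup>2"
    by (simp add: c_def s_def power_divide add_divide_distrib)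
  also have "\<dots> = 1" using r by (simp add: r_def cmod_power2[symmetric])
  finally have s2: "s\<^sup>2 = 1 - c\<^sup>2" by simp
  have "\<forall>i\<in>G \<union> H. m i > 0" using mpos unfolding R by simp
  from that[OF fin card c s s2 this r P] show ?thesis .
qed

section \<open>Numerical bounds for each split\<close>

text \<open>Up to two factors 1 + 0.64 * c are estimated jointly with s^3; each further one is
  bounded by 1.32, its value at c = 1/2.\<close>

lemma sin_cubed_power_le:
  fixes c s :: real
  assumes "0 \<le> c" "c \<le> 1 / 2" "0 \<le> s" "s\<^sup>2 = 1 - c\<^sup>2"
  shows "s ^ 3 * (1 + 0.64 * c) ^ k \<le> (if k = 0 then 1 else if k = 1 then 1.09 else 1.25 * 1.32 ^ (k - 2))"
proof -
  define K where "K = 1 + 0.64 * c"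
  have K: "0 \<le> K" "K \<le> 1.32" using assms by (auto simp: K_def)
  have "s ^ 3 \<le> 1 - 1.375 * c\<^sup>2" by (rule sin_cubed_le[OF assms])
  also have "\<dots> \<le> 1" by simp
  finally have s3: "s ^ 3 \<le> 1" .
  have large: "s ^ 3 * K ^ (j + 2) \<le> 1.25 * 1.32 ^ j" for j
  proof -
    have "s ^ 3 * K ^ (j + 2) = (s ^ 3 * K\<^sup>2) * K ^ j" by (simp add: power_add power2_eq_square)
    also have "\<dots> \<le> 1.25 * 1.32 ^ j"
      using sin_cubed_times_le(2)[OF assms] K by (intro mult_mono power_mono) (auto simp: K_def)
    finally show ?thesis .
  qed
  consider "k = 0" | "k = 1" | j where "k = j + 2"
    by (metis One_nat_def add_2_eq_Suc' not0_implies_Suc)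
  then show ?thesis
    using s3 sin_cubed_times_le(1)[OF assms] large unfolding K_def by cases auto
qed

text \<open>The maximum is over the cases \<open>c \<le> 1 / 2\<close> and \<open>c \<ge> 1 / 2\<close>; \<open>p\<close> and \<open>q\<close> are the
  cardinalities of \<open>G\<close> and \<open>H\<close>.\<close>

definition split_bound :: "nat \<Rightarrow> nat \<Rightarrow> real" where
  "split_bound p q = max
     (8 * 2 ^ min p q * (if q - 1 = 0 then 1 else if q - 1 = 1 then 1.09 else 1.25 * 1.32 ^ (q - 1 - 2)))
     (5.2 * 2 ^ min (p + 1) q * (32 / 27) ^ (q - 1))"

lemma pohst_prod_one_pair_le:
  assumes adm: "admissible n 1 y"
  obtains p q where "p + q = n - 2" "pohst_prod n y \<le> split_bound p q"
proof -
  obtain G H c s and m :: "nat \<Rightarrow> real" and r where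
    fin: "finite G" "finite H" and card: "card G + card H = n - 2"
    and c: "0 \<le> c" "c \<le> 1" and s: "0 \<le> s" "s\<^sup>2 = 1 - c\<^sup>2"
    and pos: "\<forall>i\<in>G \<union> H. m i > 0" "r > 0"
    and P: "pohst_prod n y = 2 * s *
     ((\<Prod>i\<in>G. quad (- c) (ratio (m i) r)) * (\<Prod>i\<in>H. quad c (ratio (m i) r))
     * (pair_prod (\<lambda>i j. 1 - ratio (m i) (m j)) G * pair_prod (\<lambda>i j. 1 - ratio (m i) (m j)) H
       * (\<Prod>i\<in>G. \<Prod>j\<in>H. 1 + ratio (m i) (m j))))"
    by (rule pohst_prod_config[OF adm])
  define p q where "p = card G" and "q = card H"
  define small where
    "small = 8 * 2 ^ min p q *
      (if q - 1 = 0 then 1 else if q - 1 = 1 then 1.09 else 1.25 * 1.32 ^ (q - 1 - 2) :: real)"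
  define large where "large = (5.2 * 2 ^ min (p + 1) q * (32 / 27) ^ (q - 1) :: real)"
  have "pohst_prod n y \<le> small" if c2: "c \<le> 1 / 2"
  proof -
    have "pohst_prod n y \<le> 2 * s * (2 ^ min p q * (4 * (1 - c\<^sup>2) * (1 + 0.64 * c) ^ (q - 1)))"
      unfolding P p_def q_def using fin pos c(1) c2 s(1)
      by (intro mult_left_mono[OF config_le_small_cos]) auto
    also have "\<dots> = 8 * 2 ^ min p q * (s ^ 3 * (1 + 0.64 * c) ^ (q - 1))"
    proof -
      have "2 * s * (N * (4 * s\<^sup>2 * L)) = 8 * N * (s ^ 3 * L)" for N L
        by (simp add: power2_eq_square power3_eq_cube)
      then show ?thesis unfolding s(2)[symmetric] .
    qed
    also have "\<dots> \<le> small"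
      unfolding small_def by (intro mult_left_mono sin_cubed_power_le c(1) c2 s) simp
    finally show ?thesis .
  qed
  moreover have "pohst_prod n y \<le> large" if c2: "1 / 2 \<le> c"
  proof -
    have "pohst_prod n y \<le> 2 * s * (2 ^ min (p + 1) q * (2 * ((1 + c) * (32 / 27) ^ (q - 1))))"
      unfolding P p_def q_def using fin pos c(2) c2 s(1)
      by (intro mult_left_mono[OF config_le_large_cos]) auto
    also have "\<dots> = 4 * (s * (1 + c)) * (2 ^ min (p + 1) q * (32 / 27) ^ (q - 1))"
    proof -
      have "2 * s * (N * (2 * ((1 + c) * L))) = 4 * (s * (1 + c)) * (N * L)" for N L by simp
      then show ?thesis .
    qed
    also have "\<dots> \<le> 4 * 1.3 * (2 ^ min (p + 1) q * (32 / 27) ^ (q - 1))"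
      using sin_times_one_plus_cos_le[OF c(1) s] by (intro mult_right_mono mult_left_mono) auto
    also have "\<dots> = large" by (simp add: large_def)
    finally show ?thesis .
  qed
  ultimately have "pohst_prod n y \<le> max small large"
    using linear[of c "1 / 2"] by (auto simp: le_max_iff_disj)
  then have "pohst_prod n y \<le> split_bound p q"
    unfolding split_bound_def small_def large_def .
  with card show ?thesis unfolding p_def q_def by (rule that)
qed

text \<open>The worst split is p = q = 2 with small cosine: 8 * 4 * 1.09 = 34.88.\<close>

lemma pohst_prod_6_1_le:
  assumes "admissible 6 1 y"
  shows "pohst_prod 6 y \<le> 34.89"
proof -
  obtain p q where pq: "p + q = 6 - 2" "pohst_prod 6 y \<le> split_bound p q"
    by (rule pohst_prod_one_pair_le[OF assms])
  then have "q \<in> {0, 1, 2, 3, 4}" "p = 4 - q" by auto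
  then show ?thesis
    using pq(2) by (auto simp: split_bound_def power_divide le_max_iff_disj)
qed

lemma pohst_prod_7_1_le:
  assumes "admissible 7 1 y"
  shows "pohst_prod 7 y \<le> 65.81"
proof -
  obtain p q where pq: "p + q = 7 - 2" "pohst_prod 7 y \<le> split_bound p q"
    by (rule pohst_prod_one_pair_le[OF assms])
  then have "q \<in> {0, 1, 2, 3, 4, 5}" "p = 5 - q" by auto
  then show ?thesis
    using pq(2) by (auto simp: split_bound_def power_divide le_max_iff_disj)
qed

text \<open>The split p = q = 3 with small cosine gives exactly 8 * 8 * 1.25 = 80.\<close>

lemma pohst_prod_8_1_le:
  assumes "admissible 8 1 y"
  shows "pohst_prod 8 y \<le> 80"
proof -
  obtain p q where pq: "p + q = 8 - 2" "pohst_prod 8 y \<le> split_bound p q"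
    by (rule pohst_prod_one_pair_le[OF assms])
  then have "q \<in> {0, 1, 2, 3, 4, 5, 6}" "p = 6 - q" by auto
  then show ?thesis
    using pq(2) by (auto simp: split_bound_def power_divide le_max_iff_disj)
qed

text \<open>The worst split is p = 3, q = 4 with large cosine, where the bound is below 139.\<close>

lemma pohst_prod_9_1_le:
  assumes "admissible 9 1 y"
  shows "pohst_prod 9 y \<le> 233.1"
proof -
  obtain p q where pq: "p + q = 9 - 2" "pohst_prod 9 y \<le> split_bound p q"
    by (rule pohst_prod_one_pair_le[OF assms])
  then have "q \<in> {0, 1, 2, 3, 4, 5, 6, 7}" "p = 7 - q" by auto
  then show ?thesis
    using pq(2) by (auto simp: split_bound_def power_divide le_max_iff_disj)
qed

theorem theorem2:
  "(\<forall>y :: nat \<Rightarrow> complex. admissible 6 1 y \<longrightarrow> pohst_prod 6 y \<le> 34.89) \<and>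
   (\<forall>y :: nat \<Rightarrow> complex. admissible 7 1 y \<longrightarrow> pohst_prod 7 y \<le> 65.81) \<and>
   (\<forall>y :: nat \<Rightarrow> complex. admissible 8 1 y \<longrightarrow> pohst_prod 8 y \<le> 80) \<and>
   (\<forall>y :: nat \<Rightarrow> complex. admissible 9 1 y \<longrightarrow> pohst_prod 9 y \<le> 233.1)"
  using pohst_prod_6_1_le pohst_prod_7_1_le pohst_prod_8_1_le pohst_prod_9_1_le by simp

end
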